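(* Let $n\ge 1$ and let $p,q\in\mathcal{P}(\mathbb{R}^n)$ be such that at least one of the following three conditions holds: (a) $p(x)\ge 1$ for almost every $x\in\mathbb{R}^n$, and $q$ is equal almost everywhere to a constant which is $\ge 1$; (b) $1\le q(x)\le p(x)\le\infty$ for almost every $x\in\mathbb{R}^n$; (c) $\frac{1}{p(x)}+\frac{1}{q(x)}\le 1$ for almost every $x\in\mathbb{R}^n$. Then $\|\cdot\,|\,\ell_{q(\cdot)}(L_{p(\cdot)})\|$ defines a norm (on the space of sequences $(f_\nu)_{\nu\in\mathbb{N}_0}$ of functions in $L_{p(\cdot)}(\mathbb{R}^n)$ for which it is finite).
   Context: $\mathcal{P}(\mathbb{R}^n)$ denotes the class of all measurable functions $p:\mathbb{R}^n\to(0,\infty]$ with $\operatorname{ess\,inf}_{x\in\mathbb{R}^n}p(x)>0$. For $t\ge 0$ and $p\in(0,\infty]$ put $\varphi_p(t)=t^p$ if $p\in(0,\infty)$; $\varphi_\infty(t)=0$ if $t\le 1$ and $\varphi_\infty(t)=\infty$ if $t>1$. For $p\in\mathcal{P}(\mathbb{R}^n)$ and a measurable function $f$ on $\mathbb{R}^n$ (functions equal almost everywhere are identified) define the modular $$\varrho_{p(\cdot)}(f)=\int_{\mathbb{R}^n}\varphi_{p(x)}(|f(x)|)\,dx\in[0,\infty].$$ The variable exponent Lebesgue space $L_{p(\cdot)}(\mathbb{R}^n)$ consists of all measurable $f$ for which there is $\lambda>0$ with $\varrho_{p(\cdot)}(f/\lambda)<\infty$. For $p,q\in\mathcal{P}(\mathbb{R}^n)$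 and a sequence $(f_\nu)_{\nu\in\mathbb{N}_0}$ of functions in $L_{p(\cdot)}(\mathbb{R}^n)$ define $$\varrho_{\ell_{q(\cdot)}(L_{p(\cdot)})}(f_\nu)=\sum_{\nu=0}^\infty\inf\left\{\lambda_\nu>0:\ \varrho_{p(\cdot)}\left(\frac{f_\nu}{\lambda_\nu^{1/q(\cdot)}}\right)\le 1\right\},$$ where $f_\nu/\lambda_\nu^{1/q(\cdot)}$ is the function $x\mapsto f_\nu(x)/\lambda_\nu^{1/q(x)}$, with the convention $\lambda^{1/\infty}:=1$ for $\lambda>0$, and $$\|f_\nu\,|\,\ell_{q(\cdot)}(L_{p(\cdot)})\|=\inf\left\{\mu>0:\ \varrho_{\ell_{q(\cdot)}(L_{p(\cdot)})}(f_\nu/\mu)\le 1\right\}.$$ Conventions: $1/\infty=0$ and $\inf\emptyset=\infty$. *)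

theory Defs
  imports "HOL-Analysis.Analysis"
begin

definition essinf :: "'a measure \<Rightarrow> ('a \<Rightarrow> 'b::complete_linorder) \<Rightarrow> 'b" where
  "essinf M f = Sup {z. AE x in M. z \<le> f x}"

definition exponents :: "('a::euclidean_space \<Rightarrow> ennreal) set" where
  "exponents = {p \<in> borel_measurable lebesgue. (\<forall>x. 0 < p x) \<and> 0 < essinf lebesgue p}"

definition phi :: "ennreal \<Rightarrow> real \<Rightarrow> ennreal" where
  "phi p t = (if p = \<infinity> then (if t \<le> 1 then 0 else \<infinity>) else ennreal (t powr enn2real p))"

definition modular ::
    "('a::euclidean_space \<Rightarrow> ennreal) \<Rightarrow> ('a \<Rightarrow> 'b::real_normed_vector) \<Rightarrow> ennreal" where
  "modular p f = (\<integral>\<^sup>+ x. phi (p x) (norm (f x)) \<partial>lebesgue)"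

definition Lp_space ::
    "('a::euclidean_space \<Rightarrow> ennreal) \<Rightarrow> ('a \<Rightarrow> 'b::real_normed_vector) set" where
  "Lp_space p = {f \<in> borel_measurable lebesgue. \<exists>l::real. l > 0 \<and> modular p (\<lambda>x. f x /\<^sub>R l) < \<infinity>}"

(* In ennreal, 1 / \<infinity> = 0, and l powr 0 = 1 for l > 0, so l powr enn2real (1 / \<infinity>) = 1. *)
definition mixed_modular ::
    "('a::euclidean_space \<Rightarrow> ennreal) \<Rightarrow> ('a \<Rightarrow> ennreal) \<Rightarrow>
      (nat \<Rightarrow> 'a \<Rightarrow> 'b::real_normed_vector) \<Rightarrow> ennreal" where
  "mixed_modular q p f =
    (\<Sum>k. Inf {ennreal l | l::real. l > 0 \<and>
                modular p (\<lambda>x. f k x /\<^sub>R (l powr enn2real (1 / q x))) \<le> 1})"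

definition mixed_norm ::
    "('a::euclidean_space \<Rightarrow> ennreal) \<Rightarrow> ('a \<Rightarrow> ennreal) \<Rightarrow>
      (nat \<Rightarrow> 'a \<Rightarrow> 'b::real_normed_vector) \<Rightarrow> ennreal" where
  "mixed_norm q p f =
    Inf {ennreal m | m::real. m > 0 \<and> mixed_modular q p (\<lambda>k x. f k x /\<^sub>R m) \<le> 1}"

definition mixed_space ::
    "('a::euclidean_space \<Rightarrow> ennreal) \<Rightarrow> ('a \<Rightarrow> ennreal) \<Rightarrow>
      (nat \<Rightarrow> 'a \<Rightarrow> 'b::real_normed_vector) set" where
  "mixed_space q p = {f. (\<forall>k. f k \<in> Lp_space p) \<and> mixed_norm q p f < \<infinity>}"

definition ae_eq :: "(nat \<Rightarrow> 'a::euclidean_space \<Rightarrow> 'b) \<Rightarrow> (nat \<Rightarrow> 'a \<Rightarrow> 'b) \<Rightarrow> bool" where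
  "ae_eq f g \<longleftrightarrow> (\<forall>k. AE x in lebesgue. f k x = g k x)"

(* V is a set of representatives: V modulo ae_eq is a vector space over the scalar field 'b,
   and N descends to a norm on that quotient. *)
definition norm_on_ae_classes ::
    "(nat \<Rightarrow> 'a::euclidean_space \<Rightarrow> 'b::real_normed_field) set \<Rightarrow>
      ((nat \<Rightarrow> 'a \<Rightarrow> 'b) \<Rightarrow> ennreal) \<Rightarrow> bool" where
  "norm_on_ae_classes V N \<longleftrightarrow>
    (\<lambda>k x. 0) \<in> V \<and>
    (\<forall>f\<in>V. \<forall>g\<in>V. (\<lambda>k x. f k x + g k x) \<in> V) \<and>
    (\<forall>c. \<forall>f\<in>V. (\<lambda>k x. c * f k x) \<in> V) \<and>
    (\<forall>f\<in>V. \<forall>g. ae_eq f g \<longrightarrow> g \<in> V \<and> N g = N f) \<and>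
    (\<forall>f\<in>V. N f < \<infinity>) \<and>
    (\<forall>f\<in>V. N f = 0 \<longleftrightarrow> ae_eq f (\<lambda>k x. 0)) \<and>
    (\<forall>c. \<forall>f\<in>V. N (\<lambda>k x. c * f k x) = ennreal (norm c) * N f) \<and>
    (\<forall>f\<in>V. \<forall>g\<in>V. N (\<lambda>k x. f k x + g k x) \<le> N f + N g)"

end

theory Submission
  imports Defs
begin

text \<open>Only the triangle inequality needs work, and it follows once each summand of the mixed
  modular (\<open>level\<close> below) is convex. Let \<open>u + v = 1\<close>, let \<open>l\<close> be a member of the set whose infimum defines the summand of \<open>f\<close>, likewise
  \<open>m\<close> for \<open>g\<close>, and put \<open>k = u l + v m\<close>, \<open>s = l / k\<close>, \<open>t = m / k\<close>. Convexity reduces to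
  the pointwise bound
  \<open>\<phi>\<^sub>p (u s\<^bsup>1/q\<^esup> a + v t\<^bsup>1/q\<^esup> b) \<le> w \<phi>\<^sub>p a + z \<phi>\<^sub>p b\<close> with \<open>w + z = 1\<close> independent of \<open>x\<close>.
  In case (a) take \<open>w\<close> proportional to \<open>u s\<^bsup>1/q\<^esup>\<close>, in case (b) \<open>w = u s\<close> (convexity of \<open>y\<^bsup>q\<^esup>\<close>, then of
  \<open>y\<^bsup>p/q\<^esup>\<close>), and in case (c) \<open>w = u\<close> (Hoelder's inequality).\<close>

section \<open>Powers and the integrand \<open>phi\<close> at finite and infinite exponents\<close>

lemma powr_convex_combination:
  fixes x y u v p :: real
  assumes "1 \<le> p" "0 \<le> x" "0 \<le> y" "0 \<le> u" "0 \<le> v" "u + v = 1"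
  shows "(u * x + v * y) powr p \<le> u * x powr p + v * y powr p"
proof -
  have le: "w powr p \<le> w" if "0 \<le> w" "w \<le> 1" for w :: real
    using powr_mono'[of 1 p w] that assms(1) by simp
  \<comment> \<open>If one point is 0, the claim reduces to \<open>a powr p <= a\<close> for a
    weight \<open>a\<close> in [0, 1]; convexity is then applied to positive points only.\<close>
  have zero: "(a * z) powr p \<le> a * z powr p" if "0 \<le> a" "a \<le> 1" "0 \<le> z" for a z :: real
    using le[of a] that by (simp add: powr_mult mult_right_mono)
  consider "x = 0" | "y = 0" | "0 < x" "0 < y"
    using assms by fastforce
  then show ?thesis
  proof cases
    case 1
    then show ?thesis using zero[of v y] assms by simp
  next
    case 2
    then show ?thesis using zero[of u x] assms by simp
  next
    case 3
    then show ?thesis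
      using convex_onD[OF powr_convex[OF assms(1)], of v x y] assms
      by (simp add: eq_diff_eq[symmetric])
  qed
qed

text \<open>Concavity of \<open>z powr r\<close> enters as its tangent bound at 1, which is Young's
  inequality with second factor 1; the weighted tangents add up to
  \<open>r + (1 - r)\<close>.\<close>

lemma powr_concave_combination:
  fixes s t u v r :: real
  assumes "0 \<le> r" "r \<le> 1" "0 < s" "0 < t" "0 \<le> u" "0 \<le> v" "u * s + v * t = 1" "u + v = 1"
  shows "u * s powr r + v * t powr r \<le> 1"
proof -
  have le: "z powr r \<le> r * z + (1 - r)" if "0 < z" for z :: real
    using Youngs_inequality_0[of r "1 - r" z 1] that assms by simp
  have "u * s powr r + v * t powr r \<le> u * (r * s + (1 - r)) + v * (r * t + (1 - r))"
    using le assms by (intro add_mono mult_left_mono) auto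
  also have "\<dots> = r * (u * s + v * t) + (1 - r) * (u + v)"
    by (simp add: algebra_simps)
  finally show ?thesis using assms by simp
qed

lemma phi_ennreal: "0 \<le> P \<Longrightarrow> phi (ennreal P) t = ennreal (t powr P)"
  by (simp add: phi_def)

lemma phi_0 [simp]: "phi p 0 = 0"
  by (simp add: phi_def)

lemma phi_mono: "0 \<le> a \<Longrightarrow> a \<le> b \<Longrightarrow> phi p a \<le> phi p b"
  by (auto simp: phi_def intro!: ennreal_leI powr_mono2)

text \<open>At p = infinity \<open>phi\<close> takes only the values 0 and infinity, so any positive
  weights \<open>w\<close>, \<open>z\<close> will do, unrelated to \<open>c\<close> and
  \<open>d\<close>. Hence the weights chosen for finite exponents also work here.\<close>

lemma phi_top_combination:
  assumes "0 \<le> a" "0 \<le> b" "0 \<le> c" "0 \<le> d" "c + d \<le> 1" "0 < w" "0 < z"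
  shows "phi \<infinity> (c * a + d * b) \<le> ennreal w * phi \<infinity> a + ennreal z * phi \<infinity> b"
proof (cases "a \<le> 1 \<and> b \<le> 1")
  case True
  then have "c * a + d * b \<le> c + d"
    using assms by (intro add_mono mult_left_le) auto
  then show ?thesis
    using assms by (simp add: phi_def)
next
  case False
  then show ?thesis
    using assms by (auto simp: phi_def ennreal_mult_top)
qed

lemma phi_finite_combination:
  assumes "x powr P \<le> w * a powr P + z * b powr P" "0 \<le> P" "0 \<le> w" "0 \<le> z"
  shows "phi (ennreal P) x \<le> ennreal w * phi (ennreal P) a + ennreal z * phi (ennreal P) b"
  using assms by (simp add: phi_ennreal ennreal_leI flip: ennreal_plus ennreal_mult)

lemma phi_convex:
  assumes "1 \<le> p" "0 \<le> a" "0 \<le> b" "0 < u" "0 < v" "u + v = 1"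
  shows "phi p (u * a + v * b) \<le> ennreal u * phi p a + ennreal v * phi p b"
proof (cases p rule: ennreal_cases)
  case (real P)
  then have "1 \<le> P" using assms(1) by simp
  then show ?thesis
    unfolding \<open>p = ennreal P\<close> using assms
    by (intro phi_finite_combination powr_convex_combination) auto
next
  case top
  then show ?thesis
    using phi_top_combination[of a b u v u v] assms by simp
qed

text \<open>Convexity between \<open>a\<close> and 0, where \<open>phi\<close> vanishes.\<close>

lemma phi_scale:
  assumes "1 \<le> p" "0 \<le> a" "0 < s" "s < 1"
  shows "phi p (s * a) \<le> ennreal s * phi p a"
  using phi_convex[of p a 0 s "1 - s"] assms by simp

section \<open>The pointwise inequalities\<close>

text \<open>Dividing by \<open>c + d <= 1\<close> only enlarges the argument and turns it into a
  genuine convex combination.\<close>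

lemma phi_weighted_constant:
  assumes p: "1 \<le> p" and ab: "0 \<le> a" "0 \<le> b" and cd: "0 < c" "0 < d" "c + d \<le> 1"
  shows "phi p (c * a + d * b) \<le> ennreal (c / (c + d)) * phi p a + ennreal (d / (c + d)) * phi p b"
proof -
  have "c * a + d * b = (c + d) * (c / (c + d) * a + d / (c + d) * b)"
    using cd by (simp add: distrib_left)
  also have "\<dots> \<le> 1 * (c / (c + d) * a + d / (c + d) * b)"
    using ab cd by (intro mult_right_mono) auto
  finally have "phi p (c * a + d * b) \<le> phi p (c / (c + d) * a + d / (c + d) * b)"
    using ab cd by (intro phi_mono) auto
  also have "\<dots> \<le> ennreal (c / (c + d)) * phi p a + ennreal (d / (c + d)) * phi p b"
    using assms by (intro phi_convex) (auto simp: add_divide_distrib[symmetric])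
  finally show ?thesis .
qed

text \<open>With \<open>r\<close> = 1/q the hypotheses say 1 <= q <= P. Convexity at the exponent q
  with weights \<open>u\<close>, \<open>v\<close> turns \<open>s powr r\<close> into
  \<open>s\<close>; then \<open>u * s\<close> and \<open>v * t\<close> are convex weights for the
  exponent P/q.\<close>

lemma powr_weighted_less_equal:
  fixes P r :: real
  assumes "0 < r" "r \<le> 1" "1 \<le> P * r" "0 \<le> a" "0 \<le> b"
    and uv: "0 < u" "0 < v" "u + v = 1" and st: "0 < s" "0 < t" "u * s + v * t = 1"
  shows "(u * s powr r * a + v * t powr r * b) powr P \<le> u * s * a powr P + v * t * b powr P"
proof -
  define Q where "Q = 1 / r"
  have Q: "1 \<le> Q" "1 \<le> P / Q" "r * Q = 1" "Q * (P / Q) = P" "0 < Q"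
    using assms by (auto simp: Q_def field_simps)
  have "(u * s powr r * a + v * t powr r * b) powr Q
      = (u * (s powr r * a) + v * (t powr r * b)) powr Q"
    by (simp add: mult.assoc)
  also have "\<dots> \<le> u * (s powr r * a) powr Q + v * (t powr r * b) powr Q"
    using assms Q by (intro powr_convex_combination) auto
  also have "\<dots> = u * s * a powr Q + v * t * b powr Q"
    using assms Q by (simp add: powr_mult powr_powr)
  finally have le: "(u * s powr r * a + v * t powr r * b) powr Q \<le> u * s * a powr Q + v * t * b powr Q" .
  have "(u * s powr r * a + v * t powr r * b) powr P
      = ((u * s powr r * a + v * t powr r * b) powr Q) powr (P / Q)"
    using Q by (simp add: powr_powr)
  also have "\<dots> \<le> (u * s * a powr Q + v * t * b powr Q) powr (P / Q)"
    using Q le by (intro powr_mono2) auto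
  also have "\<dots> \<le> u * s * (a powr Q) powr (P / Q) + v * t * (b powr Q) powr (P / Q)"
    using assms Q by (intro powr_convex_combination) auto
  also have "\<dots> = u * s * a powr P + v * t * b powr P"
    using Q by (simp add: powr_powr)
  finally show ?thesis .
qed

text \<open>Hoelder's inequality by way of Jensen's: the weights \<open>U\<close>, \<open>V\<close>
  are \<open>u * s powr (r * R)\<close> and \<open>v * t powr (r * R)\<close> divided by their sum
  \<open>T\<close>. Since \<open>r <= 1 - 1 / P\<close> means \<open>r * R <= 1\<close>, concavity
  gives \<open>T <= 1\<close>.\<close>

lemma powr_weighted_Holder:
  fixes P r :: real
  assumes "1 \<le> P" "0 \<le> r" "r \<le> 1 - 1 / P" "0 \<le> a" "0 \<le> b"
    and uv: "0 < u" "0 < v" "u + v = 1" and st: "0 < s" "0 < t" "u * s + v * t = 1"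
  shows "(u * s powr r * a + v * t powr r * b) powr P \<le> u * a powr P + v * b powr P"
proof (cases "P = 1")
  \<comment> \<open>This exponent has no finite conjugate; it forces \<open>r = 0\<close>, and then
    both sides agree.\<close>
  case True
  then show ?thesis using assms by simp
next
  case False
  then have P: "1 < P" using assms by simp
  \<comment> \<open>the exponent conjugate to \<open>P\<close>\<close>
  define R where "R = P / (P - 1)"
  \<comment> \<open>The last identity is what cancels the powers of \<open>s\<close> and
    \<open>t\<close> once \<open>A\<close> and \<open>B\<close> are raised to the power
    \<open>P\<close>.\<close>
  have R: "r * R \<le> 1" "0 \<le> R" "R + (1 - R) * P = 0"
    using P assms(2,3) by (auto simp: R_def field_simps)
  define T where "T = u * s powr (r * R) + v * t powr (r * R)"
  have T: "T \<le> 1"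
    unfolding T_def using assms R by (intro powr_concave_combination) auto
  have T0: "0 < T"
    unfolding T_def using assms by (intro add_pos_pos mult_pos_pos) auto
  define U V where "U = u * s powr (r * R) / T" and "V = v * t powr (r * R) / T"
  define A B where "A = s powr (r * (1 - R)) * a" and "B = t powr (r * (1 - R)) * b"
  have UV: "0 \<le> U" "0 \<le> V" "U + V = 1"
    using T0 uv by (auto simp: U_def V_def T_def add_divide_distrib[symmetric])
  have AB: "0 \<le> A" "0 \<le> B"
    using assms by (auto simp: A_def B_def)
  have split: "z powr r = z powr (r * R) * z powr (r * (1 - R))" for z :: real
    by (simp add: powr_add[symmetric] algebra_simps)
  have pow: "z powr (r * R) * (z powr (r * (1 - R)) * c) powr P = c powr P"
    if "0 < z" "0 \<le> c" for z c :: real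
  proof -
    have "z powr (r * R) * (z powr (r * (1 - R)) * c) powr P
        = z powr (r * (R + (1 - R) * P)) * c powr P"
      using that by (simp add: powr_mult powr_powr powr_add[symmetric] algebra_simps)
    then show ?thesis using R that by simp
  qed
  have "u * s powr r * a + v * t powr r * b = T * (U * A + V * B)"
    using T0 unfolding U_def V_def A_def B_def split[of s] split[of t]
    by (simp add: field_simps)
  then have "(u * s powr r * a + v * t powr r * b) powr P = T powr P * (U * A + V * B) powr P"
    using T0 UV AB by (simp add: powr_mult)
  also have "\<dots> \<le> T powr P * (U * A powr P + V * B powr P)"
    using assms UV AB by (intro mult_left_mono powr_convex_combination) auto
  \<comment> \<open>\<open>U\<close> and \<open>V\<close> each carry a factor \<open>1 / T\<close>,
    so \<open>T powr (P - 1)\<close> remains, which is at most 1.\<close>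
  also have "\<dots> = T powr P / T * (u * (s powr (r * R) * A powr P) + v * (t powr (r * R) * B powr P))"
    using T0 by (simp add: U_def V_def field_simps)
  also have "\<dots> = T powr (P - 1) * (u * a powr P + v * b powr P)"
    using T0 assms pow by (simp add: A_def B_def powr_diff)
  also have "\<dots> \<le> 1 * (u * a powr P + v * b powr P)"
    using T T0 P uv powr_mono2[of "P - 1" T 1] by (intro mult_right_mono) auto
  finally show ?thesis by simp
qed

lemma ennreal_inverse_le_1_iff: "1 / q \<le> 1 \<longleftrightarrow> (1::ennreal) \<le> q"
proof (cases q rule: ennreal_cases)
  case (real Q)
  show ?thesis
  proof (cases "Q = 0")
    case False
    then show ?thesis
      using real by (simp add: divide_ennreal flip: ennreal_1)
  qed (simp add: real top_unique)
qed simp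

lemma enn2real_inverse_le_1: "1 \<le> (q::ennreal) \<Longrightarrow> enn2real (1 / q) \<le> 1"
  using ennreal_inverse_le_1_iff[of q] enn2real_mono[of "1 / q" 1] by simp

text \<open>A finite \<open>p\<close> forces a finite \<open>q\<close>, and the bound for real
  powers applies. For infinite \<open>p\<close> it suffices that the two coefficients sum to at most
  1, which is concavity with exponent 1/q <= 1.\<close>

lemma phi_weighted_less_equal:
  assumes pq: "1 \<le> q" "q \<le> p" and ab: "0 \<le> a" "0 \<le> b"
    and uv: "0 < u" "0 < v" "u + v = 1" and st: "0 < s" "0 < t" "u * s + v * t = 1"
  shows "phi p (u * s powr enn2real (1 / q) * a + v * t powr enn2real (1 / q) * b)
    \<le> ennreal (u * s) * phi p a + ennreal (v * t) * phi p b"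
proof (cases p rule: ennreal_cases)
  case (real P)
  then obtain Q where Q: "q = ennreal Q" "0 \<le> Q"
    using pq by (cases q rule: ennreal_cases) (auto simp: top_unique)
  have PQ: "1 \<le> Q" "Q \<le> P"
    using pq real Q by auto
  then have r: "enn2real (1 / q) = 1 / Q"
    using Q by (simp add: divide_ennreal flip: ennreal_1)
  show ?thesis
    unfolding r \<open>p = ennreal P\<close> using assms PQ
    by (intro phi_finite_combination powr_weighted_less_equal) auto
next
  case top
  then show ?thesis
    using phi_top_combination[of a b "u * s powr enn2real (1 / q)" "v * t powr enn2real (1 / q)"
        "u * s" "v * t"] assms
      powr_concave_combination[of "enn2real (1 / q)" s t u v] enn2real_inverse_le_1[of q]
    by simp
qed

lemma phi_weighted_Holder:
  assumes pq: "1 / p + 1 / q \<le> (1::ennreal)" and ab: "0 \<le> a" "0 \<le> b"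
    and uv: "0 < u" "0 < v" "u + v = 1" and st: "0 < s" "0 < t" "u * s + v * t = 1"
  shows "phi p (u * s powr enn2real (1 / q) * a + v * t powr enn2real (1 / q) * b)
    \<le> ennreal u * phi p a + ennreal v * phi p b"
proof -
  \<comment> \<open>Each reciprocal is at most the sum, so both exponents are at least 1.\<close>
  have le: "1 / p \<le> 1" "1 / q \<le> 1"
    using order_trans[OF _ pq] by simp_all
  then have q: "1 \<le> q" and p: "1 \<le> p"
    by (simp_all add: ennreal_inverse_le_1_iff)
  define r where "r = enn2real (1 / q)"
  have r: "1 / q = ennreal r" "0 \<le> r"
    using order.strict_trans1[OF le(2) ennreal_one_less_top]
    by (simp_all add: r_def ennreal_enn2real)
  show ?thesis
  proof (cases p rule: ennreal_cases)
    case (real P)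
    then have "1 \<le> P" using p by simp
    then have "1 / p = ennreal (1 / P)"
      using real by (simp add: divide_ennreal flip: ennreal_1)
    then have "ennreal (1 / P + r) \<le> 1"
      using pq r real by (simp add: ennreal_plus)
    then have "r \<le> 1 - 1 / P"
      by simp
    then show ?thesis
      unfolding r_def[symmetric] \<open>p = ennreal P\<close> using assms r \<open>1 \<le> P\<close>
      by (intro phi_finite_combination powr_weighted_Holder) auto
  next
    case top
    then show ?thesis
      using phi_top_combination[of a b "u * s powr enn2real (1 / q)" "v * t powr enn2real (1 / q)"
          u v] assms
        powr_concave_combination[of "enn2real (1 / q)" s t u v] enn2real_inverse_le_1[OF q]
      by simp
  qed
qed

section \<open>The three cases and weights common to almost all points\<close>

definition admissible ::
    "('a::euclidean_space \<Rightarrow> ennreal) \<Rightarrow> ('a \<Rightarrow> ennreal) \<Rightarrow> bool" where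
  "admissible p q \<longleftrightarrow>
    ((AE x in lebesgue. 1 \<le> p x) \<and> (\<exists>c. 1 \<le> c \<and> (AE x in lebesgue. q x = c))) \<or>
    (AE x in lebesgue. 1 \<le> q x \<and> q x \<le> p x) \<or>
    (AE x in lebesgue. 1 / p x + 1 / q x \<le> 1)"

lemma admissible_ge_1:
  assumes "admissible p q"
  shows "AE x in lebesgue. 1 \<le> p x" "AE x in lebesgue. 1 \<le> q x"
proof -
  have sum: "1 \<le> a \<and> 1 \<le> b" if "1 / a + 1 / b \<le> (1::ennreal)" for a b
    using that order_trans[of "1 / a" "1 / a + 1 / b" 1] order_trans[of "1 / b" "1 / a + 1 / b" 1]
    by (simp add: ennreal_inverse_le_1_iff)
  have "AE x in lebesgue. 1 \<le> p x \<and> 1 \<le> q x"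
    using assms unfolding admissible_def
  proof (elim disjE conjE exE)
    fix c assume "AE x in lebesgue. 1 \<le> p x" "1 \<le> c" "AE x in lebesgue. q x = c"
    then show ?thesis by (auto elim: eventually_elim2)
  qed (auto elim: eventually_mono intro: order_trans dest: sum)
  then show "AE x in lebesgue. 1 \<le> p x" "AE x in lebesgue. 1 \<le> q x"
    by (auto elim: eventually_mono)
qed

text \<open>The weights are fixed before \<open>x\<close>, so that they leave the integral as
  constants. The quantifiers over \<open>a\<close> and \<open>b\<close> stand inside
  \<open>AE\<close>, so one null set serves all values of the functions inserted later.\<close>

lemma admissible_weights:
  assumes adm: "admissible p q"
    and uv: "0 < u" "0 < v" "u + v = 1" and st: "0 < s" "0 < t" "u * s + v * t = 1"
  obtains w z where "0 < w" "0 < z" "w + z = 1"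
    "AE x in lebesgue. \<forall>a b. 0 \<le> a \<longrightarrow> 0 \<le> b \<longrightarrow>
      phi (p x) (u * s powr enn2real (1 / q x) * a + v * t powr enn2real (1 / q x) * b)
        \<le> ennreal w * phi (p x) a + ennreal z * phi (p x) b"
  using adm unfolding admissible_def
proof (elim disjE conjE exE)
  fix c assume *: "AE x in lebesgue. 1 \<le> p x" "1 \<le> c" "AE x in lebesgue. q x = c"
  \<comment> \<open>As \<open>q\<close> is almost everywhere the constant \<open>c\<close>, these do
    not depend on \<open>x\<close>. For infinite \<open>c\<close> the exponent is 0, and they are
    \<open>u\<close> and \<open>v\<close>.\<close>
  define C D where "C = u * s powr enn2real (1 / c)" and "D = v * t powr enn2real (1 / c)"
  have CD: "0 < C" "0 < D" "C + D \<le> 1"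
    using uv st powr_concave_combination[of "enn2real (1 / c)" s t u v]
      enn2real_inverse_le_1[OF \<open>1 \<le> c\<close>]
    by (auto simp: C_def D_def)
  show thesis
  proof (rule that)
    show "0 < C / (C + D)" "0 < D / (C + D)" "C / (C + D) + D / (C + D) = 1"
      using CD by (auto simp: add_divide_distrib[symmetric])
    show "AE x in lebesgue. \<forall>a b. 0 \<le> a \<longrightarrow> 0 \<le> b \<longrightarrow>
      phi (p x) (u * s powr enn2real (1 / q x) * a + v * t powr enn2real (1 / q x) * b)
        \<le> ennreal (C / (C + D)) * phi (p x) a + ennreal (D / (C + D)) * phi (p x) b"
      using *(1,3)
    proof eventually_elim
      case (elim x)
      show ?case
        unfolding elim(2) C_def[symmetric] D_def[symmetric]
        using elim(1) CD by (intro allI impI phi_weighted_constant)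
    qed
  qed
next
  assume *: "AE x in lebesgue. 1 \<le> q x \<and> q x \<le> p x"
  show thesis
  proof (rule that)
    show "0 < u * s" "0 < v * t" "u * s + v * t = 1"
      using uv st by auto
    show "AE x in lebesgue. \<forall>a b. 0 \<le> a \<longrightarrow> 0 \<le> b \<longrightarrow>
      phi (p x) (u * s powr enn2real (1 / q x) * a + v * t powr enn2real (1 / q x) * b)
        \<le> ennreal (u * s) * phi (p x) a + ennreal (v * t) * phi (p x) b"
      using * by eventually_elim (use uv st phi_weighted_less_equal in blast)
  qed
next
  assume *: "AE x in lebesgue. 1 / p x + 1 / q x \<le> 1"
  show thesis
  proof (rule that[OF uv])
    show "AE x in lebesgue. \<forall>a b. 0 \<le> a \<longrightarrow> 0 \<le> b \<longrightarrow>
      phi (p x) (u * s powr enn2real (1 / q x) * a + v * t powr enn2real (1 / q x) * b)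
        \<le> ennreal u * phi (p x) a + ennreal v * phi (p x) b"
      using * by eventually_elim (use uv st phi_weighted_Holder in blast)
  qed
qed

section \<open>The modular\<close>

lemma measurable_phi [measurable]:
  assumes [measurable]: "p \<in> borel_measurable M" "f \<in> borel_measurable M"
  shows "(\<lambda>x. phi (p x) (f x)) \<in> borel_measurable M"
  unfolding phi_def by measurable

lemma modular_cong:
  "AE x in lebesgue. norm (f x) = norm (g x) \<Longrightarrow> modular p f = modular p g"
  unfolding modular_def by (rule nn_integral_cong_AE) (auto elim: eventually_mono)

lemma modular_mono:
  "AE x in lebesgue. norm (f x) \<le> norm (g x) \<Longrightarrow> modular p f \<le> modular p g"
  unfolding modular_def
  by (rule nn_integral_mono_AE) (auto elim!: eventually_mono intro!: phi_mono)

lemma modular_zero [simp]: "modular p (\<lambda>x. 0) = 0"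
  by (simp add: modular_def)

lemma modular_le_combination:
  assumes [measurable]: "p \<in> borel_measurable lebesgue" "f \<in> borel_measurable lebesgue"
      "g \<in> borel_measurable lebesgue"
    and "AE x in lebesgue. phi (p x) (norm (h x))
      \<le> ennreal w * phi (p x) (norm (f x)) + ennreal z * phi (p x) (norm (g x))"
  shows "modular p h \<le> ennreal w * modular p f + ennreal z * modular p g"
proof -
  have "modular p h \<le> (\<integral>\<^sup>+x. ennreal w * phi (p x) (norm (f x))
      + ennreal z * phi (p x) (norm (g x)) \<partial>lebesgue)"
    unfolding modular_def by (rule nn_integral_mono_AE) fact
  also have "\<dots> = ennreal w * modular p f + ennreal z * modular p g"
    unfolding modular_def by (simp add: nn_integral_add nn_integral_cmult)
  finally show ?thesis .
qed

lemma modular_scale: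
  fixes f :: "'a::euclidean_space \<Rightarrow> 'b::euclidean_space"
  assumes "p \<in> borel_measurable lebesgue" "f \<in> borel_measurable lebesgue"
    and "AE x in lebesgue. 1 \<le> p x" "0 < s" "s < 1"
  shows "modular p (\<lambda>x. s *\<^sub>R f x) \<le> ennreal s * modular p f"
proof -
  \<comment> \<open>The bound for two functions is reused with second weight 0.\<close>
  have "modular p (\<lambda>x. s *\<^sub>R f x) \<le> ennreal s * modular p f + ennreal 0 * modular p f"
    using assms
    by (intro modular_le_combination) (auto elim!: eventually_mono intro!: phi_scale)
  then show ?thesis by simp
qed

lemma Lp_space_add:
  fixes f g :: "'a::euclidean_space \<Rightarrow> 'b::euclidean_space"
  assumes p: "p \<in> borel_measurable lebesgue" "AE x in lebesgue. 1 \<le> p x"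
    and f: "f \<in> Lp_space p" and g: "g \<in> Lp_space p"
  shows "(\<lambda>x. f x + g x) \<in> Lp_space p"
proof -
  obtain l m where lm: "0 < l" "0 < m"
    and fin: "modular p (\<lambda>x. f x /\<^sub>R l) < \<infinity>" "modular p (\<lambda>x. g x /\<^sub>R m) < \<infinity>"
    using f g unfolding Lp_space_def by auto
  have [measurable]: "f \<in> borel_measurable lebesgue" "g \<in> borel_measurable lebesgue"
    using f g unfolding Lp_space_def by auto
  \<comment> \<open>The quotient by \<open>l + m\<close> is the convex combination of f/l and g/m
    with weights \<open>l / (l + m)\<close> and \<open>m / (l + m)\<close>.\<close>
  have "modular p (\<lambda>x. (f x + g x) /\<^sub>R (l + m))
    \<le> ennreal (l / (l + m)) * modular p (\<lambda>x. f x /\<^sub>R l)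
      + ennreal (m / (l + m)) * modular p (\<lambda>x. g x /\<^sub>R m)"
  proof (rule modular_le_combination)
    show "AE x in lebesgue. phi (p x) (norm ((f x + g x) /\<^sub>R (l + m)))
      \<le> ennreal (l / (l + m)) * phi (p x) (norm (f x /\<^sub>R l))
        + ennreal (m / (l + m)) * phi (p x) (norm (g x /\<^sub>R m))"
      using p(2)
    proof eventually_elim
      case (elim x)
      have "norm ((f x + g x) /\<^sub>R (l + m))
          \<le> l / (l + m) * norm (f x /\<^sub>R l) + m / (l + m) * norm (g x /\<^sub>R m)"
        using lm norm_triangle_ineq[of "f x" "g x"]
        by (simp add: divide_simps)
      then have "phi (p x) (norm ((f x + g x) /\<^sub>R (l + m)))
          \<le> phi (p x) (l / (l + m) * norm (f x /\<^sub>R l) + m / (l + m) * norm (g x /\<^sub>R m))"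
        by (intro phi_mono) auto
      also have "\<dots> \<le> ennreal (l / (l + m)) * phi (p x) (norm (f x /\<^sub>R l))
        + ennreal (m / (l + m)) * phi (p x) (norm (g x /\<^sub>R m))"
        using elim lm by (intro phi_convex) (auto simp: add_divide_distrib[symmetric])
      finally show ?case .
    qed
  qed (use p in measurable)
  also have "\<dots> < \<infinity>"
    using fin by (simp add: ennreal_mult_less_top)
  finally show ?thesis
    using lm unfolding Lp_space_def by (auto intro!: exI[of _ "l + m"])
qed

lemma Lp_space_cmult:
  fixes f :: "'a::euclidean_space \<Rightarrow> 'b::{real_normed_field, euclidean_space}"
  assumes f: "f \<in> Lp_space p"
  shows "(\<lambda>x. c * f x) \<in> Lp_space p"
proof (cases "c = 0")
  case True
  then show ?thesis by (auto simp: Lp_space_def intro: exI[of _ 1])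
next
  case False
  obtain l where l: "0 < l" "modular p (\<lambda>x. f x /\<^sub>R l) < \<infinity>"
    using f unfolding Lp_space_def by auto
  have "modular p (\<lambda>x. (c * f x) /\<^sub>R (norm c * l)) = modular p (\<lambda>x. f x /\<^sub>R l)"
    using False by (intro modular_cong) (simp add: norm_mult abs_mult)
  then show ?thesis
    using f l False unfolding Lp_space_def
    by (auto intro!: exI[of _ "norm c * l"])
qed

section \<open>The mixed modular and the mixed norm\<close>

text \<open>The infima need not be attained, so near-minimisers are used. An infinite right-hand
  side, as for an empty set, is trivial. Serves both for the summands of the modular and for the
  norm itself.\<close>

lemma Inf_le_combination:
  fixes A B :: "ennreal set" and u v :: real
  assumes uv: "0 < u" "0 < v"
    and le: "\<And>a b. a \<in> A \<Longrightarrow> b \<in> B \<Longrightarrow> c \<le> ennreal u * a + ennreal v * b"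
  shows "c \<le> ennreal u * Inf A + ennreal v * Inf B"
proof (rule ennreal_le_epsilon)
  fix e :: real
  assume fin: "ennreal u * Inf A + ennreal v * Inf B < top" and e: "0 < e"
  \<comment> \<open>Chosen so that the errors \<open>u * d\<close> and \<open>v * d\<close> sum to
    exactly \<open>e\<close>.\<close>
  define d where "d = e / (u + v)"
  have d: "0 < d" "u * d + v * d = e"
    using uv e nonzero_mult_div_cancel_left[of "u + v" e]
    by (simp_all add: d_def flip: distrib_right add_divide_distrib)
  have "Inf A < top" "Inf B < top"
    using fin uv by (auto simp: ennreal_mult_less_top)
  moreover have "x < x + ennreal d" if "x < top" for x
    using that d by (cases x rule: ennreal_cases) (auto simp: ennreal_less_iff simp flip: ennreal_plus)
  ultimately have "Inf A < Inf A + ennreal d" "Inf B < Inf B + ennreal d"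
    by blast+
  then obtain a b where ab: "a \<in> A" "a < Inf A + ennreal d" "b \<in> B" "b < Inf B + ennreal d"
    unfolding Inf_less_iff by blast
  have "c \<le> ennreal u * a + ennreal v * b"
    using le ab by blast
  also have "\<dots> \<le> ennreal u * (Inf A + ennreal d) + ennreal v * (Inf B + ennreal d)"
    using ab by (intro add_mono mult_left_mono) auto
  also have "\<dots> = ennreal u * Inf A + ennreal v * Inf B + ennreal e"
    unfolding d(2)[symmetric] using uv d(1) by (simp add: ennreal_mult distrib_left add_ac)
  finally show "c \<le> ennreal u * Inf A + ennreal v * Inf B + ennreal e" .
qed

section \<open>Convexity of each summand and of the mixed modular\<close>

definition level ::
    "('a::euclidean_space \<Rightarrow> ennreal) \<Rightarrow> ('a \<Rightarrow> ennreal) \<Rightarrow> ('a \<Rightarrow> 'b::real_normed_vector) \<Rightarrow> ennreal"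
  where "level q p f = Inf {ennreal l | l::real. l > 0 \<and>
    modular p (\<lambda>x. f x /\<^sub>R (l powr enn2real (1 / q x))) \<le> 1}"

lemma mixed_modular_level: "mixed_modular q p f = (\<Sum>k. level q p (f k))"
  by (simp add: mixed_modular_def level_def)

text \<open>Stated for norms so that it covers both almost everywhere equality and scalar factors of
  modulus 1.\<close>

lemma level_cong:
  assumes "AE x in lebesgue. norm (f x) = norm (g x)"
  shows "level q p f = level q p g"
proof -
  have "modular p (\<lambda>x. f x /\<^sub>R (l powr enn2real (1 / q x)))
      = modular p (\<lambda>x. g x /\<^sub>R (l powr enn2real (1 / q x)))" for l
    using assms by (intro modular_cong) (auto elim: eventually_mono)
  then show ?thesis by (simp add: level_def)
qed

lemma level_convex:
  fixes f g :: "'a::euclidean_space \<Rightarrow> 'b::euclidean_space"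
  assumes adm: "admissible p q"
    and [measurable]: "p \<in> borel_measurable lebesgue" "q \<in> borel_measurable lebesgue"
      "f \<in> borel_measurable lebesgue" "g \<in> borel_measurable lebesgue"
    and uv: "0 < u" "0 < v" "u + v = 1"
  shows "level q p (\<lambda>x. u *\<^sub>R f x + v *\<^sub>R g x) \<le> ennreal u * level q p f + ennreal v * level q p g"
  unfolding level_def[of q p f] level_def[of q p g]
proof (rule Inf_le_combination[OF uv(1,2)], safe)
  fix l m :: real
  define F where "F = (\<lambda>x. f x /\<^sub>R (l powr enn2real (1 / q x)))"
  define G where "G = (\<lambda>x. g x /\<^sub>R (m powr enn2real (1 / q x)))"
  assume lm: "0 < l" "0 < m"
    and "modular p (\<lambda>x. f x /\<^sub>R (l powr enn2real (1 / q x))) \<le> 1"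
    and "modular p (\<lambda>x. g x /\<^sub>R (m powr enn2real (1 / q x))) \<le> 1"
  then have le: "modular p F \<le> 1" "modular p G \<le> 1"
    by (simp_all add: F_def G_def)
  have [measurable]: "F \<in> borel_measurable lebesgue" "G \<in> borel_measurable lebesgue"
    unfolding F_def G_def by measurable
  \<comment> \<open>This choice is what makes the weights \<open>u * (l / k)\<close> and
    \<open>v * (m / k)\<close> sum to 1; the goal is that \<open>k\<close> belongs to the set
    defining the level of the combination.\<close>
  define k where "k = u * l + v * m"
  have k: "0 < k" using uv lm by (simp add: k_def add_pos_pos)
  define H where "H = (\<lambda>x. (u *\<^sub>R f x + v *\<^sub>R g x) /\<^sub>R (k powr enn2real (1 / q x)))"
  have sum: "u * (l / k) + v * (m / k) = 1"
    using k by (simp add: k_def add_divide_distrib[symmetric])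
  then obtain w z where wz: "0 < w" "0 < z" "w + z = 1"
    and phi: "AE x in lebesgue. \<forall>a b. 0 \<le> a \<longrightarrow> 0 \<le> b \<longrightarrow>
      phi (p x) (u * (l / k) powr enn2real (1 / q x) * a + v * (m / k) powr enn2real (1 / q x) * b)
        \<le> ennreal w * phi (p x) a + ennreal z * phi (p x) b"
    using admissible_weights[OF adm uv divide_pos_pos[OF lm(1) k] divide_pos_pos[OF lm(2) k] sum]
    by blast
  have "modular p H \<le> ennreal w * modular p F + ennreal z * modular p G"
  proof (rule modular_le_combination)
    show "AE x in lebesgue. phi (p x) (norm (H x))
      \<le> ennreal w * phi (p x) (norm (F x)) + ennreal z * phi (p x) (norm (G x))"
      using phi
    proof eventually_elim
      case (elim x)
      define r where "r = enn2real (1 / q x)"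
      \<comment> \<open>The factor \<open>(l / k) powr r\<close> exchanges the normalisation by
        \<open>l powr r\<close> in \<open>F\<close> for the one by \<open>k powr r\<close> in
        \<open>H\<close>; likewise for \<open>G\<close>.\<close>
      have "u * (l / k) powr r * inverse (l powr r) = inverse (k powr r) * u"
        "v * (m / k) powr r * inverse (m powr r) = inverse (k powr r) * v"
        using lm k by (simp_all add: powr_divide field_simps)
      then have "H x = (u * (l / k) powr r) *\<^sub>R F x + (v * (m / k) powr r) *\<^sub>R G x"
        unfolding H_def F_def G_def r_def[symmetric] by (simp only: scaleR_add_right scaleR_scaleR)
      then have "norm (H x) \<le> u * (l / k) powr r * norm (F x) + v * (m / k) powr r * norm (G x)"
        using uv norm_triangle_ineq[of "(u * (l / k) powr r) *\<^sub>R F x" "(v * (m / k) powr r) *\<^sub>R G x"]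
        by simp
      then have "phi (p x) (norm (H x))
        \<le> phi (p x) (u * (l / k) powr r * norm (F x) + v * (m / k) powr r * norm (G x))"
        by (intro phi_mono) auto
      also have "\<dots> \<le> ennreal w * phi (p x) (norm (F x)) + ennreal z * phi (p x) (norm (G x))"
        using elim unfolding r_def by simp
      finally show ?case .
    qed
  qed measurable
  also have "\<dots> \<le> ennreal w * 1 + ennreal z * 1"
    using le by (intro add_mono mult_left_mono) auto
  also have "\<dots> = 1"
    using wz by (simp flip: ennreal_plus)
  finally have "level q p (\<lambda>x. u *\<^sub>R f x + v *\<^sub>R g x) \<le> ennreal k"
    unfolding level_def H_def using k by (intro Inf_lower) auto
  also have "ennreal k = ennreal u * ennreal l + ennreal v * ennreal m"
    using uv lm by (simp add: k_def ennreal_plus ennreal_mult)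
  finally show "level q p (\<lambda>x. u *\<^sub>R f x + v *\<^sub>R g x)
    \<le> ennreal u * ennreal l + ennreal v * ennreal m" .
qed

lemma mixed_modular_convex:
  fixes f g :: "nat \<Rightarrow> 'a::euclidean_space \<Rightarrow> 'b::euclidean_space"
  assumes "admissible p q" "p \<in> borel_measurable lebesgue" "q \<in> borel_measurable lebesgue"
    and "\<And>k. f k \<in> borel_measurable lebesgue" "\<And>k. g k \<in> borel_measurable lebesgue"
    and "0 < u" "0 < v" "u + v = 1"
  shows "mixed_modular q p (\<lambda>k x. u *\<^sub>R f k x + v *\<^sub>R g k x)
    \<le> ennreal u * mixed_modular q p f + ennreal v * mixed_modular q p g"
proof -
  have "mixed_modular q p (\<lambda>k x. u *\<^sub>R f k x + v *\<^sub>R g k x)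
      \<le> (\<Sum>k. ennreal u * level q p (f k) + ennreal v * level q p (g k))"
    unfolding mixed_modular_level using assms by (intro suminf_le level_convex) auto
  then show ?thesis
    by (simp add: mixed_modular_level suminf_add[symmetric])
qed

section \<open>From the convex modular to the triangle inequality\<close>

lemma mixed_norm_cong:
  assumes "\<And>k. AE x in lebesgue. norm (f k x) = norm (g k x)"
  shows "mixed_norm q p f = mixed_norm q p g"
proof -
  have "level q p (\<lambda>x. f k x /\<^sub>R m) = level q p (\<lambda>x. g k x /\<^sub>R m)" for k m
    using assms[of k] by (intro level_cong) (auto elim: eventually_mono)
  then show ?thesis by (simp add: mixed_norm_def mixed_modular_level)
qed

text \<open>The Luxemburg norm argument: if \<open>l\<close> is admissible in the infimum for
  \<open>f\<close> and \<open>m\<close> in that for \<open>g\<close>, convexity makes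
  \<open>l + m\<close> admissible for the sum.\<close>

lemma mixed_norm_triangle:
  fixes f g :: "nat \<Rightarrow> 'a::euclidean_space \<Rightarrow> 'b::euclidean_space"
  assumes adm: "admissible p q"
    and pq: "p \<in> borel_measurable lebesgue" "q \<in> borel_measurable lebesgue"
    and [measurable]: "\<And>k. f k \<in> borel_measurable lebesgue" "\<And>k. g k \<in> borel_measurable lebesgue"
  shows "mixed_norm q p (\<lambda>k x. f k x + g k x) \<le> mixed_norm q p f + mixed_norm q p g"
proof -
  \<comment> \<open>The factors \<open>ennreal 1\<close> give the goal the shape of
    \<open>Inf_le_combination\<close>.\<close>
  have "mixed_norm q p (\<lambda>k x. f k x + g k x)
    \<le> ennreal 1 * mixed_norm q p f + ennreal 1 * mixed_norm q p g"
    unfolding mixed_norm_def[of q p f] mixed_norm_def[of q p g]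
  proof (rule Inf_le_combination, simp, simp, safe)
    fix l m :: real
    assume lm: "0 < l" "0 < m"
      and le: "mixed_modular q p (\<lambda>k x. f k x /\<^sub>R l) \<le> 1" "mixed_modular q p (\<lambda>k x. g k x /\<^sub>R m) \<le> 1"
    define u v where "u = l / (l + m)" and "v = m / (l + m)"
    have uv: "0 < u" "0 < v" "u + v = 1"
      using lm by (auto simp: u_def v_def add_divide_distrib[symmetric])
    have "(f k x + g k x) /\<^sub>R (l + m) = u *\<^sub>R (f k x /\<^sub>R l) + v *\<^sub>R (g k x /\<^sub>R m)" for k x
      using lm by (simp add: u_def v_def scaleR_add_right) (simp add: divide_inverse)
    then have "mixed_modular q p (\<lambda>k x. (f k x + g k x) /\<^sub>R (l + m))
      = mixed_modular q p (\<lambda>k x. u *\<^sub>R (f k x /\<^sub>R l) + v *\<^sub>R (g k x /\<^sub>R m))"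
      by simp
    also have "\<dots> \<le> ennreal u * mixed_modular q p (\<lambda>k x. f k x /\<^sub>R l)
        + ennreal v * mixed_modular q p (\<lambda>k x. g k x /\<^sub>R m)"
      using adm pq uv by (intro mixed_modular_convex) auto
    also have "\<dots> \<le> ennreal u * 1 + ennreal v * 1"
      using le by (intro add_mono mult_left_mono) auto
    also have "\<dots> = 1"
      using uv by (simp flip: ennreal_plus)
    finally have "mixed_norm q p (\<lambda>k x. f k x + g k x) \<le> ennreal (l + m)"
      unfolding mixed_norm_def using lm by (intro Inf_lower CollectI exI[of _ "l + m"]) simp
    then show "mixed_norm q p (\<lambda>k x. f k x + g k x) \<le> ennreal 1 * ennreal l + ennreal 1 * ennreal m"
      using lm by (simp add: ennreal_plus)
  qed
  then show ?thesis by simp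
qed

section \<open>The zero sequence, homogeneity and definiteness\<close>

lemma level_zero [simp]: "level q p (\<lambda>x. 0) = 0"
proof (rule antisym)
  have "level q p (\<lambda>x. 0) \<le> 0 + ennreal e" if "0 < e" for e
    unfolding level_def using that by (intro Inf_lower) auto
  then show "level q p (\<lambda>x. 0) \<le> 0"
    by (rule ennreal_le_epsilon)
qed simp

lemma mixed_norm_zero [simp]: "mixed_norm q p (\<lambda>k x. 0) = 0"
proof (rule antisym)
  have "mixed_norm q p (\<lambda>k x. 0) \<le> 0 + ennreal e" if "0 < e" for e
    unfolding mixed_norm_def using that by (intro Inf_lower) (auto simp: mixed_modular_level)
  then show "mixed_norm q p (\<lambda>k x. 0) \<le> 0"
    by (rule ennreal_le_epsilon)
qed simp

text \<open>Passing from f/m to (c f)/(|c| m) preserves the pointwise norm. The factor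
  \<open>1 / norm c\<close> is first moved to the left, so that the right-hand side is a bare
  infimum.\<close>

lemma mixed_norm_cmult_le:
  fixes f :: "nat \<Rightarrow> 'a::euclidean_space \<Rightarrow> 'b::real_normed_field"
  assumes c: "c \<noteq> 0"
  shows "mixed_norm q p (\<lambda>k x. c * f k x) \<le> ennreal (norm c) * mixed_norm q p f"
proof -
  have "ennreal (1 / norm c) * mixed_norm q p (\<lambda>k x. c * f k x) \<le> mixed_norm q p f"
    unfolding mixed_norm_def[of q p f]
  proof (rule Inf_greatest, safe)
    fix m :: real
    assume m: "0 < m" and le: "mixed_modular q p (\<lambda>k x. f k x /\<^sub>R m) \<le> 1"
    have "level q p (\<lambda>x. (c * f k x) /\<^sub>R (norm c * m)) = level q p (\<lambda>x. f k x /\<^sub>R m)" for k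
      using c m by (intro level_cong) (simp add: norm_mult abs_mult)
    then have "mixed_norm q p (\<lambda>k x. c * f k x) \<le> ennreal (norm c * m)"
      unfolding mixed_norm_def using m c le
      by (intro Inf_lower CollectI exI[of _ "norm c * m"]) (simp add: mixed_modular_level)
    then have "ennreal (1 / norm c) * mixed_norm q p (\<lambda>k x. c * f k x)
        \<le> ennreal (1 / norm c) * ennreal (norm c * m)"
      by (rule mult_left_mono) simp
    then show "ennreal (1 / norm c) * mixed_norm q p (\<lambda>k x. c * f k x) \<le> ennreal m"
      using c m by (simp flip: ennreal_mult)
  qed
  then have "ennreal (norm c) * (ennreal (1 / norm c) * mixed_norm q p (\<lambda>k x. c * f k x))
      \<le> ennreal (norm c) * mixed_norm q p f"
    by (rule mult_left_mono) simp
  then show ?thesis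
    using c by (simp add: mult.assoc[symmetric] flip: ennreal_mult)
qed

text \<open>The reverse inequality is the previous bound for \<open>inverse c\<close> and the
  sequence \<open>c * f k x\<close>. For \<open>c = 0\<close> both sides vanish, as 0 times infinity
  is 0 in \<open>ennreal\<close>.\<close>

lemma mixed_norm_cmult:
  fixes f :: "nat \<Rightarrow> 'a::euclidean_space \<Rightarrow> 'b::real_normed_field"
  shows "mixed_norm q p (\<lambda>k x. c * f k x) = ennreal (norm c) * mixed_norm q p f"
proof (cases "c = 0")
  case False
  have "ennreal (norm c) * mixed_norm q p f
      = ennreal (norm c) * mixed_norm q p (\<lambda>k x. inverse c * (c * f k x))"
    using False by (simp add: mult.assoc[symmetric])
  also have "\<dots> \<le> ennreal (norm c) * (ennreal (norm (inverse c)) * mixed_norm q p (\<lambda>k x. c * f k x))"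
    using False by (intro mult_left_mono mixed_norm_cmult_le) auto
  also have "\<dots> = mixed_norm q p (\<lambda>k x. c * f k x)"
    using False by (simp add: mult.assoc[symmetric] norm_inverse flip: ennreal_mult)
  finally show ?thesis
    using mixed_norm_cmult_le[OF False] by (intro antisym)
qed simp

text \<open>A zero norm bounds the modular of f_k/e by 1 for every \<open>e > 0\<close>; convexity
  then makes the modular of every multiple of f_k vanish. All multiples are needed because at an
  infinite exponent \<open>phi\<close> vanishes on all of [0, 1].\<close>

lemma mixed_norm_eq_0D:
  fixes f :: "nat \<Rightarrow> 'a::euclidean_space \<Rightarrow> 'b::euclidean_space"
  assumes p: "p \<in> borel_measurable lebesgue" "AE x in lebesgue. 1 \<le> p x"
    and q: "AE x in lebesgue. 1 \<le> q x"
    and [measurable]: "f k \<in> borel_measurable lebesgue"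
    and zero: "mixed_norm q p f = 0"
  shows "AE x in lebesgue. f k x = 0"
proof -
  have bounded: "modular p (\<lambda>x. f k x /\<^sub>R e) \<le> 1" if e: "0 < e" for e
  proof -
    \<comment> \<open>The half absorbs the factor \<open>l powr (1/q)\<close>, which is at most 2
      since \<open>l < 2\<close> and 1/q <= 1.\<close>
    have "mixed_norm q p f < ennreal (e / 2)"
      using zero e by simp
    then obtain m where m: "0 < m" "m < e / 2" "mixed_modular q p (\<lambda>k x. f k x /\<^sub>R m) \<le> 1"
      unfolding mixed_norm_def Inf_less_iff using e by (auto simp: ennreal_less_iff)
    have "level q p (\<lambda>x. f k x /\<^sub>R m) \<le> mixed_modular q p (\<lambda>k x. f k x /\<^sub>R m)"
      unfolding mixed_modular_level
      using sum_le_suminf[of "\<lambda>k. level q p (\<lambda>x. f k x /\<^sub>R m)" "{k}"] by simp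
    \<comment> \<open>The infimum is at most 1 but need not be attained; the strict bound 2 yields
      an actual member \<open>l\<close> of the set.\<close>
    also have "\<dots> < ennreal 2"
      using m(3) by (rule order.strict_trans1) (simp flip: ennreal_1)
    finally obtain l where l: "0 < l" "l < 2"
      "modular p (\<lambda>x. f k x /\<^sub>R m /\<^sub>R (l powr enn2real (1 / q x))) \<le> 1"
      unfolding level_def Inf_less_iff by (auto simp: ennreal_less_iff)
    have "modular p (\<lambda>x. f k x /\<^sub>R e) \<le> modular p (\<lambda>x. f k x /\<^sub>R m /\<^sub>R (l powr enn2real (1 / q x)))"
    proof (rule modular_mono, use q in eventually_elim)
      case (elim x)
      define r where "r = enn2real (1 / q x)"
      have r: "0 \<le> r" "r \<le> 1"
        using enn2real_inverse_le_1[OF elim] by (auto simp: r_def)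
      have "l powr r \<le> 2 powr r"
        using l r by (intro powr_mono2) auto
      also have "\<dots> \<le> 2 powr 1"
        using r by (intro powr_mono) auto
      finally have "m * l powr r \<le> e"
        using m mult_mono[of m "e / 2" "l powr r" 2] by simp
      then have "inverse e \<le> inverse (m * l powr r)"
        using m l by (intro le_imp_inverse_le) auto
      then have "inverse e * norm (f k x) \<le> inverse (m * l powr r) * norm (f k x)"
        by (rule mult_right_mono) simp
      then show ?case
        using e m by (simp add: r_def[symmetric] mult_ac)
    qed
    with l(3) show ?thesis by (rule order_trans[rotated])
  qed
  have null: "modular p (\<lambda>x. real j *\<^sub>R f k x) = 0" if "0 < j" for j
  proof (rule antisym)
    show "modular p (\<lambda>x. real j *\<^sub>R f k x) \<le> 0"
    proof (rule ennreal_le_epsilon)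
      fix e :: real assume "0 < e"
      \<comment> \<open>The cap 1/2 ensures \<open>s < 1\<close>, as scaling requires.\<close>
      define s where "s = min e (1 / 2)"
      have s: "0 < s" "s < 1" "s \<le> e"
        using \<open>0 < e\<close> by (auto simp: s_def)
      have "modular p (\<lambda>x. real j *\<^sub>R f k x) = modular p (\<lambda>x. s *\<^sub>R (f k x /\<^sub>R (s / j)))"
        using s by simp
      also have "\<dots> \<le> ennreal s * modular p (\<lambda>x. f k x /\<^sub>R (s / j))"
        using p s by (intro modular_scale) auto
      also have "\<dots> \<le> ennreal s * 1"
        using s \<open>0 < j\<close> by (intro mult_left_mono bounded) auto
      also have "\<dots> \<le> 0 + ennreal e"
        using s by (simp add: ennreal_leI)
      finally show "modular p (\<lambda>x. real j *\<^sub>R f k x) \<le> 0 + ennreal e" .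
    qed
  qed simp
  have "AE x in lebesgue. phi (p x) (norm (real j *\<^sub>R f k x)) = 0" if "0 < j" for j
    using null[OF that] p(1) unfolding modular_def by (subst (asm) nn_integral_0_iff_AE) auto
  \<comment> \<open>Countably many multiples share one null set.\<close>
  then have "AE x in lebesgue. \<forall>j>0. phi (p x) (norm (real j *\<^sub>R f k x)) = 0"
    by (simp add: AE_all_countable)
  then show ?thesis
  proof eventually_elim
    case (elim x)
    show ?case
    proof (rule ccontr)
      assume "f k x \<noteq> 0"
      \<comment> \<open>Above 1 the integrand is nonzero at every exponent: a positive power if it
        is finite, infinity otherwise.\<close>
      obtain j :: nat where j: "1 < real j * norm (f k x)"
        using \<open>f k x \<noteq> 0\<close> reals_Archimedean3[of "norm (f k x)"] by auto
      then have "0 < j" by (cases j) auto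
      with elim have "phi (p x) (norm (real j *\<^sub>R f k x)) = 0"
        by blast
      with j \<open>0 < j\<close> \<open>f k x \<noteq> 0\<close> show False
        by (simp add: phi_def split: if_splits)
    qed
  qed
qed

section \<open>The norm axioms on classes modulo almost everywhere equality\<close>

theorem theorem1:
  fixes p q :: "real ^ 'n \<Rightarrow> ennreal"
  assumes "p \<in> exponents" and "q \<in> exponents"
    and "((AE x in lebesgue. 1 \<le> p x) \<and> (\<exists>c. 1 \<le> c \<and> (AE x in lebesgue. q x = c))) \<or>
         (AE x in lebesgue. 1 \<le> q x \<and> q x \<le> p x) \<or>
         (AE x in lebesgue. 1 / p x + 1 / q x \<le> 1)"
  shows "norm_on_ae_classes
           (mixed_space q p :: (nat \<Rightarrow> real ^ 'n \<Rightarrow> 'b::{real_normed_field, euclidean_space}) set)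
           (mixed_norm q p)"
proof -
  let ?V = "mixed_space q p :: (nat \<Rightarrow> real ^ 'n \<Rightarrow> 'b) set"
  have adm: "admissible p q"
    using assms(3) unfolding admissible_def .
  have pq: "p \<in> borel_measurable lebesgue" "q \<in> borel_measurable lebesgue"
    using assms(1,2) by (auto simp: exponents_def)
  note ge_1 = admissible_ge_1[OF adm]
  have meas: "f k \<in> borel_measurable lebesgue" if "f \<in> ?V" for f k
    using that by (auto simp: mixed_space_def Lp_space_def)
  have triangle: "mixed_norm q p (\<lambda>k x. f k x + g k x) \<le> mixed_norm q p f + mixed_norm q p g"
    if "f \<in> ?V" "g \<in> ?V" for f g
    using adm pq meas that by (intro mixed_norm_triangle) auto
  have zero_mem: "(\<lambda>k x. 0) \<in> ?V"
    by (auto simp: mixed_space_def Lp_space_def intro: exI[of _ 1])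
  have add_mem: "(\<lambda>k x. f k x + g k x) \<in> ?V" if "f \<in> ?V" "g \<in> ?V" for f g
    using that order.strict_trans1[OF triangle[OF that], of \<infinity>] pq ge_1
    by (auto simp: mixed_space_def intro!: Lp_space_add)
  have cmult_mem: "(\<lambda>k x. c * f k x) \<in> ?V" if "f \<in> ?V" for c f
    using that by (auto simp: mixed_space_def mixed_norm_cmult ennreal_mult_less_top
        intro!: Lp_space_cmult)
  have ae: "g \<in> ?V \<and> mixed_norm q p g = mixed_norm q p f" if f: "f \<in> ?V" and "ae_eq f g" for f g
  proof -
    have eq: "AE x in lebesgue. f k x = g k x" for k
      using \<open>ae_eq f g\<close> by (simp add: ae_eq_def)
    have "AE x in lebesgue. norm (g k x) = norm (f k x)" for k
      using eq[of k] by eventually_elim simp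
    then have "mixed_norm q p g = mixed_norm q p f"
      by (rule mixed_norm_cong)
    moreover have "g k \<in> Lp_space p" for k
    proof -
      have "AE x in lebesgue. norm (g k x /\<^sub>R l) = norm (f k x /\<^sub>R l)" for l
        using eq[of k] by eventually_elim simp
      then have "modular p (\<lambda>x. g k x /\<^sub>R l) = modular p (\<lambda>x. f k x /\<^sub>R l)" for l
        by (rule modular_cong)
      \<comment> \<open>Completeness of Lebesgue measure carries measurability over to
        \<open>g k\<close>.\<close>
      moreover have "g k \<in> borel_measurable lebesgue"
        using meas[OF f] eq by (rule borel_measurable_AE)
      ultimately show ?thesis
        using f by (auto simp: mixed_space_def Lp_space_def)
    qed
    ultimately show ?thesis
      using f by (auto simp: mixed_space_def)
  qed
  have definite: "mixed_norm q p f = 0 \<longleftrightarrow> ae_eq f (\<lambda>k x. 0)" if "f \<in> ?V" for f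
  proof
    show "ae_eq f (\<lambda>k x. 0)" if "mixed_norm q p f = 0"
      unfolding ae_eq_def
      using mixed_norm_eq_0D[OF pq(1) ge_1 meas[OF \<open>f \<in> ?V\<close>] that] by blast
    show "mixed_norm q p f = 0" if "ae_eq f (\<lambda>k x. 0)"
      using ae[OF \<open>f \<in> ?V\<close> that] by simp
  qed
  show ?thesis
    unfolding norm_on_ae_classes_def
  proof (intro conjI ballI allI impI)
    show "mixed_norm q p f < \<infinity>" if "f \<in> ?V" for f
      using that by (simp add: mixed_space_def)
  qed (use ae in \<open>auto intro: zero_mem add_mem cmult_mem triangle mixed_norm_cmult simp: definite\<close>)
qed

end
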